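(* Let $V$ be a $\mathbb{Q}$-vector space of dimension $n\ge1$ and let $a_0,\dots,a_n$ be $n+1$ nonzero linear forms on $V$ which generate $V^\vee$. For $0\le j\le n$ put $\varepsilon_j=(-1)^j\,\mathrm{sign}\det(a_0,\dots,\widehat{a_j},\dots,a_n)\in\{-1,0,1\}$. (i) If there are $\lambda_0>0,\dots,\lambda_n>0$ with $\sum_{j=0}^n\lambda_ja_j=0$, then all $\varepsilon_j$ are equal to a common sign $\varepsilon$ and $$\sum_{j=0}^n\varepsilon_j\,c^\vee(a_0,\dots,\widehat{a_j},\dots,a_n)\equiv\varepsilon\,\delta\mod\mathcal{L}(V).$$ (ii) If there is a relation $\sum_{j=0}^n\lambda_ja_j=0$ with at least one positive and at least one negative coefficient among $\lambda_0,\dots,\lambda_n$, then $$\sum_{j=0}^n\varepsilon_j\,c^\vee(a_0,\dots,\widehat{a_j},\dots,a_n)\equiv0\mod\mathcal{L}(V).$$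
   Context: $V^\vee$ is the dual $\mathbb{Q}$-vector space; $\det$ is a fixed nonzero alternating $n$-form on $V^\vee$ (orientation). $\widehat{a_j}$ means omitted. For linear forms $b_1,\dots,b_m$ on $V$, $c^\vee(b_1,\dots,b_m)$ is the indicator function of $\{v\in V: b_i(v)\ge0\ \forall i\}$. A polyhedral cone in $V$ is a set $\mathbb{Q}_{\ge0}v_1+\dots+\mathbb{Q}_{\ge0}v_p+\mathbb{Q}_{>0}v'_1+\dots+\mathbb{Q}_{>0}v'_q$ with nonzero $v_i,v'_j$ (possibly $p=q=0$, giving $\{0\}$). $\mathcal{K}(V)$ is the $\mathbb{Q}$-algebra of $\mathbb{Q}$-valued functions on $V$ generated by indicator functions of polyhedral cones, and $\mathcal{L}(V)\subset\mathcal{K}(V)$ is the $\mathbb{Q}$-subspace spanned by indicator functions of closed polyhedral cones containing a line $\mathbb{Q}v$ for some $v\ne0$. $\delta$ is the indicator function of $\{0\}$. *)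

theory Defs
  imports Complex_Main "HOL-Library.Function_Algebras" "HOL-Library.Indicator_Function"
begin

text \<open>The rational vector space is the type \<open>'v\<close> with scalar multiplication \<open>scale\<close>,
  subject to \<open>vector_space scale\<close>.\<close>

definition fun_scale :: "rat \<Rightarrow> ('v \<Rightarrow> rat) \<Rightarrow> 'v \<Rightarrow> rat" where
  "fun_scale c f = (\<lambda>v. c * f v)"

lemma vector_space_fun_scale: "vector_space fun_scale"
  by unfold_locales (auto simp: fun_scale_def fun_eq_iff algebra_simps)

definition dual_space :: "(rat \<Rightarrow> 'v::ab_group_add \<Rightarrow> 'v) \<Rightarrow> ('v \<Rightarrow> rat) set" where
  "dual_space scale = {f. Vector_Spaces.linear scale (*) f}"

text \<open>An \<open>n\<close>-form on the dual space is evaluated on lists of length \<open>n\<close> of linear forms; its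
  values on all other lists are irrelevant.\<close>

definition alternating_form ::
  "(rat \<Rightarrow> 'v::ab_group_add \<Rightarrow> 'v) \<Rightarrow> nat \<Rightarrow> (('v \<Rightarrow> rat) list \<Rightarrow> rat) \<Rightarrow> bool" where
  "alternating_form scale n D \<longleftrightarrow>
     (\<forall>bs. length bs = n \<and> set bs \<subseteq> dual_space scale \<longrightarrow>
        (\<forall>i<n. \<forall>f\<in>dual_space scale. \<forall>g\<in>dual_space scale.
           D (bs[i := f + g]) = D (bs[i := f]) + D (bs[i := g])) \<and>
        (\<forall>i<n. \<forall>f\<in>dual_space scale. \<forall>c.
           D (bs[i := fun_scale c f]) = c * D (bs[i := f])) \<and>
        (\<forall>i<n. \<forall>j<n. i \<noteq> j \<and> bs ! i = bs ! j \<longrightarrow> D bs = 0))"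

definition nonzero_form ::
  "(rat \<Rightarrow> 'v::ab_group_add \<Rightarrow> 'v) \<Rightarrow> nat \<Rightarrow> (('v \<Rightarrow> rat) list \<Rightarrow> rat) \<Rightarrow> bool" where
  "nonzero_form scale n D \<longleftrightarrow>
     (\<exists>bs. length bs = n \<and> set bs \<subseteq> dual_space scale \<and> D bs \<noteq> 0)"

definition generated_cone :: "(rat \<Rightarrow> 'v::ab_group_add \<Rightarrow> 'v) \<Rightarrow> 'v list \<Rightarrow> 'v list \<Rightarrow> 'v set" where
  "generated_cone scale vs ws =
     {(\<Sum>i<length vs. scale (s i) (vs ! i)) + (\<Sum>j<length ws. scale (t j) (ws ! j)) | s t.
        (\<forall>i<length vs. 0 \<le> s i) \<and> (\<forall>j<length ws. 0 < t j)}"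

definition polyhedral_cone :: "(rat \<Rightarrow> 'v::ab_group_add \<Rightarrow> 'v) \<Rightarrow> 'v set \<Rightarrow> bool" where
  "polyhedral_cone scale C \<longleftrightarrow>
     (\<exists>vs ws. 0 \<notin> set vs \<and> 0 \<notin> set ws \<and> C = generated_cone scale vs ws)"

text \<open>A polyhedral cone is closed if it can be written without strictly positive coefficients.\<close>

definition closed_polyhedral_cone :: "(rat \<Rightarrow> 'v::ab_group_add \<Rightarrow> 'v) \<Rightarrow> 'v set \<Rightarrow> bool" where
  "closed_polyhedral_cone scale C \<longleftrightarrow>
     (\<exists>vs. 0 \<notin> set vs \<and> C = generated_cone scale vs [])"

definition contains_line :: "(rat \<Rightarrow> 'v::ab_group_add \<Rightarrow> 'v) \<Rightarrow> 'v set \<Rightarrow> bool" where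
  "contains_line scale C \<longleftrightarrow> (\<exists>v. v \<noteq> 0 \<and> range (\<lambda>t. scale t v) \<subseteq> C)"

text \<open>The algebra \<open>\<K>(V)\<close>. It contains the constant function 1, the indicator function of the
  polyhedral cone \<open>V\<close>, when \<open>V\<close> is finite-dimensional.\<close>

inductive_set cone_algebra :: "(rat \<Rightarrow> 'v::ab_group_add \<Rightarrow> 'v) \<Rightarrow> ('v \<Rightarrow> rat) set"
  for scale :: "rat \<Rightarrow> 'v::ab_group_add \<Rightarrow> 'v" where
  indicator: "polyhedral_cone scale C \<Longrightarrow> indicator C \<in> cone_algebra scale"
| scale: "f \<in> cone_algebra scale \<Longrightarrow> fun_scale c f \<in> cone_algebra scale"
| add: "f \<in> cone_algebra scale \<Longrightarrow> g \<in> cone_algebra scale \<Longrightarrow> f + g \<in> cone_algebra scale"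
| mult: "f \<in> cone_algebra scale \<Longrightarrow> g \<in> cone_algebra scale \<Longrightarrow> f * g \<in> cone_algebra scale"

text \<open>The subspace \<open>\<L>(V)\<close> of \<open>\<K>(V)\<close>.\<close>

definition line_subspace :: "(rat \<Rightarrow> 'v::ab_group_add \<Rightarrow> 'v) \<Rightarrow> ('v \<Rightarrow> rat) set" where
  "line_subspace scale =
     module.span fun_scale
       {indicator C | C. closed_polyhedral_cone scale C \<and> contains_line scale C}"

definition cong_mod_lines ::
  "(rat \<Rightarrow> 'v::ab_group_add \<Rightarrow> 'v) \<Rightarrow> ('v \<Rightarrow> rat) \<Rightarrow> ('v \<Rightarrow> rat) \<Rightarrow> bool" where
  "cong_mod_lines scale f g \<longleftrightarrow>
     f \<in> cone_algebra scale \<and> g \<in> cone_algebra scale \<and> f - g \<in> line_subspace scale"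

definition dual_cone_indicator :: "('v \<Rightarrow> rat) list \<Rightarrow> 'v \<Rightarrow> rat" where
  "dual_cone_indicator bs = indicator {v. \<forall>b\<in>set bs. 0 \<le> b v}"

text \<open>The list of \<open>a\<^sub>0, \<dots>, a\<^sub>n\<close> with \<open>a\<^sub>j\<close> removed.\<close>

definition omit :: "nat \<Rightarrow> (nat \<Rightarrow> 'b) \<Rightarrow> nat \<Rightarrow> 'b list" where
  "omit n a j = map a ([0..<j] @ [Suc j..<Suc n])"

definition omit_sign :: "(('v \<Rightarrow> rat) list \<Rightarrow> rat) \<Rightarrow> nat \<Rightarrow> (nat \<Rightarrow> 'v \<Rightarrow> rat) \<Rightarrow> nat \<Rightarrow> rat" where
  "omit_sign D n a j = (-1) ^ j * sgn (D (omit n a j))"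

end

theory Submission imports Defs
begin

text \<open>Write \<open>x\<^sub>i\<close> for the indicator function of the half-space \<open>a\<^sub>i \<ge> 0\<close>. Let \<open>l\<close> be a
  relation between the forms, positive on a nonempty set \<open>P\<close> of indices and nonpositive
  elsewhere. Then \<open>\<Prod>\<^sub>P (x\<^sub>i - 1) \<cdot> \<Prod>\<^sub>Q x\<^sub>i = 0\<close>, where \<open>Q\<close> is the complement of \<open>P\<close>. In the
  expansion, the terms omitting at least two forms are indicator functions of closed cones
  containing lines: \<open>a\<close> without one index of \<open>P\<close> is a basis of the dual space, so these cones
  can be generated by a dual basis. Hence the sum of the cones omitting one index of \<open>P\<close> is
  congruent to the cone of all \<open>a\<^sub>i\<close>. In case (i) take for \<open>P\<close> all indices; the cone of all
  \<open>a\<^sub>i\<close> is then \<open>{0}\<close>. In case (ii) subtract the congruence for \<open>- l\<close> from that for \<open>l\<close>. The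
  signs agree because the signed determinants \<open>(-1)\<^sup>j det(a\<^sub>0, \<dots>, a\<^sub>n)\<close>, with \<open>a\<^sub>j\<close> omitted, are a
  nonzero multiple of \<open>l\<close>: put the relation in the place of \<open>a\<^sub>k\<close> in the determinant omitting
  \<open>a\<^sub>j\<close>.\<close>

section \<open>Linear forms and the dual space\<close>

lemma sum_fun_apply: "(sum f A) x = (\<Sum>i\<in>A. f i x)"
  for f :: "'i \<Rightarrow> 'x \<Rightarrow> 'c::comm_monoid_add"
  by (induction A rule: infinite_finite_induct) auto

lemma fun_scale_apply [simp]: "fun_scale c f v = c * f v"
  by (simp add: fun_scale_def)

interpretation fun_space: vector_space "fun_scale :: rat \<Rightarrow> ('x \<Rightarrow> rat) \<Rightarrow> 'x \<Rightarrow> rat"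
  by (rule vector_space_fun_scale)

lemma dual_space_iff:
  assumes "vector_space scale"
  shows "f \<in> dual_space scale \<longleftrightarrow>
    (\<forall>x y. f (x + y) = f x + f y) \<and> (\<forall>c x. f (scale c x) = c * f x)"
proof -
  have "vector_space ((*) :: rat \<Rightarrow> rat \<Rightarrow> rat)"
    by unfold_locales (auto simp: algebra_simps)
  then show ?thesis
    using assms unfolding dual_space_def Vector_Spaces.linear_iff by auto
qed

lemma dual_space_subspace:
  assumes "vector_space scale"
  shows "fun_space.subspace (dual_space scale)"
  unfolding fun_space.subspace_def
  by (auto simp: dual_space_iff[OF assms] algebra_simps)

lemma
  assumes "vector_space scale" "f \<in> dual_space scale"
  shows dual_add: "f (x + y) = f x + f y"
    and dual_scale: "f (scale c x) = c * f x"
    and dual_zero: "f 0 = 0"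
    and dual_minus: "f (- x) = - f x"
    and dual_diff: "f (x - y) = f x - f y"
    and dual_sum: "f (sum g A) = (\<Sum>i\<in>A. f (g i))"
proof -
  have add: "f (x + y) = f x + f y" for x y
    using assms dual_space_iff by blast
  show "f (x + y) = f x + f y" by (rule add)
  show "f (scale c x) = c * f x"
    using assms dual_space_iff by blast
  show zero: "f 0 = 0"
    using add[of 0 0] by simp
  show minus: "f (- x) = - f x" for x
    using add[of x "- x"] zero by simp
  show "f (x - y) = f x - f y"
    using add[of x "- y"] minus by simp
  show "f (sum g A) = (\<Sum>i\<in>A. f (g i))"
    by (induction A rule: infinite_finite_induct) (auto simp: zero add)
qed

lemma exists_dual_nonzero:
  assumes "vector_space scale" "v \<noteq> 0"
  obtains f where "f \<in> dual_space scale" "f v \<noteq> 0"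
proof -
  interpret vector_space scale by fact
  interpret R: vector_space "(*) :: rat \<Rightarrow> rat \<Rightarrow> rat"
    by unfold_locales (auto simp: algebra_simps)
  interpret P: vector_space_pair scale "(*) :: rat \<Rightarrow> rat \<Rightarrow> rat" ..
  have "independent {v}"
    using assms(2) by (simp add: dependent_single)
  from P.linear_independent_extend[OF this, of "\<lambda>_. 1"]
  obtain g where "Vector_Spaces.linear scale (*) g" "g v = 1"
    by auto
  then show thesis
    using that[of g] by (auto simp: dual_space_def)
qed

text \<open>Evaluation at the forms \<open>f i\<close> maps the space into a function space of
  dimension at most \<open>card J\<close>. With fewer forms than the dimension this map has a
  nontrivial kernel.\<close>

lemma exists_common_zero:
  fixes f :: "'i \<Rightarrow> 'v::ab_group_add \<Rightarrow> rat"
  assumes vs: "vector_space scale"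
    and J: "finite J" "card J < vector_space.dim scale (UNIV :: 'v set)"
    and f: "\<And>i. i \<in> J \<Longrightarrow> f i \<in> dual_space scale"
  obtains w where "w \<noteq> 0" "\<And>i. i \<in> J \<Longrightarrow> f i w = 0"
proof (rule ccontr)
  note witness = that
  assume no: "\<not> thesis"
  interpret vector_space scale by fact
  interpret P: vector_space_pair scale "fun_scale :: rat \<Rightarrow> ('i \<Rightarrow> rat) \<Rightarrow> _" ..
  \<comment> \<open>Cutting off outside \<open>J\<close> makes \<open>T\<close> linear, since only
    the \<open>f i\<close> with \<open>i\<close> in \<open>J\<close> are known to be, and puts its
    range into the span of the finitely many unit functions \<open>e i\<close>.\<close>
  define T where "T v i = (if i \<in> J then f i v else 0)" for v i
  define e :: "'i \<Rightarrow> 'i \<Rightarrow> rat" where "e i k = (if k = i then 1 else 0)" for i k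
  have lin: "Vector_Spaces.linear scale fun_scale T"
    unfolding Vector_Spaces.linear_iff using vs vector_space_fun_scale
    by (auto simp: T_def fun_eq_iff dual_add[OF vs f] dual_scale[OF vs f])
  have "v = 0" if "T v = 0" for v
  proof (rule ccontr)
    assume "v \<noteq> 0"
    moreover have "f i v = 0" if "i \<in> J" for i
      using \<open>T v = 0\<close> that by (auto simp: T_def fun_eq_iff split: if_splits)
    ultimately show False using witness no by blast
  qed
  then have inj: "inj T"
    unfolding P.linear_inj_iff_eq_0[OF lin] by blast
  obtain B where B: "independent B" "card B = dim (UNIV :: 'v set)"
    using basis_exists[of UNIV] by metis
  have "T v \<in> fun_space.span (e ` J)" for v
  proof -
    have "T v = (\<Sum>i\<in>J. fun_scale (f i v) (e i))"
      using J(1) by (auto simp: fun_eq_iff sum_fun_apply T_def e_def if_distrib cong: if_cong)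
    also have "\<dots> \<in> fun_space.span (e ` J)"
      by (intro fun_space.span_sum fun_space.span_scale fun_space.span_base) auto
    finally show ?thesis .
  qed
  moreover have "fun_space.independent (T ` B)"
    using P.linear_independent_injective_image[OF lin B(1)] inj by (auto intro: inj_on_subset)
  ultimately have "card (T ` B) \<le> card (e ` J)"
    using fun_space.independent_span_bound[of "e ` J" "T ` B"] J(1) by blast
  also have "\<dots> \<le> card J"
    by (simp add: J(1) card_image_le)
  finally show False
    using B(2) J(2) card_image[of T B] inj_on_subset[OF inj] by simp
qed

section \<open>Alternating forms\<close>

text \<open>These turn the clauses of \<open>alternating_form\<close>, phrased by list update, into
  rules for a list split at the slot in question, the shape that inductions over lists
  produce.\<close>

lemma
  assumes alt: "alternating_form scale n D"
    and len: "Suc (length xs + length ys) = n"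
    and sub: "set xs \<subseteq> dual_space scale" "set ys \<subseteq> dual_space scale"
    and f: "f \<in> dual_space scale"
  shows alternating_form_add:
      "g \<in> dual_space scale \<Longrightarrow> D (xs @ (f + g) # ys) = D (xs @ f # ys) + D (xs @ g # ys)"
    and alternating_form_scale: "D (xs @ fun_scale c f # ys) = c * D (xs @ f # ys)"
    and alternating_form_repeated: "f \<in> set xs \<union> set ys \<Longrightarrow> D (xs @ f # ys) = 0"
proof -
  let ?bs = "xs @ f # ys" and ?i = "length xs"
  have "length ?bs = n \<and> set ?bs \<subseteq> dual_space scale"
    using len sub f by simp
  note alt' = alt[unfolded alternating_form_def, THEN spec, THEN mp, OF this]
  note add = alt'[THEN conjunct1] and scl = alt'[THEN conjunct2, THEN conjunct1]
    and rep = alt'[THEN conjunct2, THEN conjunct2]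
  have i: "?i < n"
    using len by simp
  show "D (xs @ (f + g) # ys) = D (xs @ f # ys) + D (xs @ g # ys)" if "g \<in> dual_space scale"
    using add[rule_format, OF i f that] by (simp only: list_update_length)
  show "D (xs @ fun_scale c f # ys) = c * D (xs @ f # ys)"
    using scl[rule_format, OF i f, of c] by (simp only: list_update_length)
  show "D (xs @ f # ys) = 0" if "f \<in> set xs \<union> set ys"
  proof -
    have rep': "D ?bs = 0" if "j < n" "?i \<noteq> j" "?bs ! j = f" for j
    proof -
      have "?bs ! ?i = ?bs ! j"
        using that(3) by simp
      then show ?thesis
        using rep that(1,2) i by blast
    qed
    from that show ?thesis
    proof
      assume "f \<in> set xs"
      then obtain j where "j < length xs" "xs ! j = f"
        by (metis in_set_conv_nth)
      then show ?thesis
        using len by (intro rep'[of j]) (simp_all add: nth_append)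
    next
      assume "f \<in> set ys"
      then obtain j where "j < length ys" "ys ! j = f"
        by (metis in_set_conv_nth)
      then show ?thesis
        using len by (intro rep'[of "Suc (?i + j)"]) (simp_all add: nth_append)
    qed
  qed
qed

lemma alternating_form_zero:
  assumes "vector_space scale" "alternating_form scale n D"
    and "Suc (length xs + length ys) = n"
    and "set xs \<subseteq> dual_space scale" "set ys \<subseteq> dual_space scale"
  shows "D (xs @ 0 # ys) = 0"
proof -
  have "0 \<in> dual_space scale"
    by (rule fun_space.subspace_0[OF dual_space_subspace[OF assms(1)]])
  from alternating_form_scale[OF assms(2-5) this, of 0] show ?thesis
    by simp
qed

lemma alternating_form_sum:
  assumes "vector_space scale" "alternating_form scale n D"
    and "Suc (length xs + length ys) = n"
    and "set xs \<subseteq> dual_space scale" "set ys \<subseteq> dual_space scale"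
    and "finite A" "\<And>i. i \<in> A \<Longrightarrow> f i \<in> dual_space scale"
  shows "D (xs @ (\<Sum>i\<in>A. fun_scale (c i) (f i)) # ys) = (\<Sum>i\<in>A. c i * D (xs @ f i # ys))"
  using assms(6,7)
proof (induction A rule: finite_induct)
  case empty
  show "D (xs @ (\<Sum>i\<in>{}. fun_scale (c i) (f i)) # ys) = (\<Sum>i\<in>{}. c i * D (xs @ f i # ys))"
    using alternating_form_zero[OF assms(1-5)] by simp
next
  case (insert x A)
  note sub = dual_space_subspace[OF assms(1)]
  have "(\<Sum>i\<in>A. fun_scale (c i) (f i)) \<in> dual_space scale"
    using insert.prems by (intro fun_space.subspace_sum[OF sub] fun_space.subspace_scale[OF sub]) auto
  moreover have "fun_scale (c x) (f x) \<in> dual_space scale"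
    using insert.prems by (intro fun_space.subspace_scale[OF sub]) auto
  ultimately have "D (xs @ (fun_scale (c x) (f x) + (\<Sum>i\<in>A. fun_scale (c i) (f i))) # ys) =
      c x * D (xs @ f x # ys) + D (xs @ (\<Sum>i\<in>A. fun_scale (c i) (f i)) # ys)"
    using insert.prems alternating_form_add[OF assms(2-5)] alternating_form_scale[OF assms(2-5)]
    by simp
  also have "D (xs @ (\<Sum>i\<in>A. fun_scale (c i) (f i)) # ys) = (\<Sum>i\<in>A. c i * D (xs @ f i # ys))"
    by (rule insert.IH) (use insert.prems in auto)
  finally show "D (xs @ (\<Sum>i\<in>insert x A. fun_scale (c i) (f i)) # ys) =
      (\<Sum>i\<in>insert x A. c i * D (xs @ f i # ys))"
    by (simp only: sum.insert[OF insert.hyps])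
qed

text \<open>Polarization: with \<open>f + g\<close> in both adjacent slots the form vanishes, and in
  the expansion only the two mixed terms survive.\<close>

lemma alternating_form_swap:
  assumes vs: "vector_space scale" and alt: "alternating_form scale n D"
    and len: "length (xs @ f # g # ys) = n"
    and sub: "set (xs @ f # g # ys) \<subseteq> dual_space scale"
  shows "D (xs @ f # g # ys) = - D (xs @ g # f # ys)"
proof -
  have fg: "f + g \<in> dual_space scale"
    using sub by (intro fun_space.subspace_add[OF dual_space_subspace[OF vs]]) auto
  note rep = alternating_form_repeated[OF alt]
    and add = alternating_form_add[OF alt]
  have 1: "D (xs @ h # (f + g) # ys) = D (xs @ h # f # ys) + D (xs @ h # g # ys)"
    if "h \<in> dual_space scale" for h
    using add[of "xs @ [h]" ys f g] len sub that by simp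
  have 2: "D (xs @ (f + g) # h # ys) = D (xs @ f # h # ys) + D (xs @ g # h # ys)"
    if "h \<in> dual_space scale" for h
    using add[of xs "h # ys" f g] len sub that by simp
  have 0: "D (xs @ h # h # ys) = 0" if "h \<in> dual_space scale" for h
    using rep[of xs "h # ys" h] len sub that by simp
  have "0 = D (xs @ (f + g) # (f + g) # ys)"
    using 0[OF fg] by simp
  also have "\<dots> = D (xs @ f # (f + g) # ys) + D (xs @ g # (f + g) # ys)"
    by (rule 2[OF fg])
  also have "\<dots> = D (xs @ f # g # ys) + D (xs @ g # f # ys)"
    using 1[of f] 1[of g] 0[of f] 0[of g] sub by simp
  finally show ?thesis by simp
qed

text \<open>\<open>f\<close> travels left past the entries of \<open>ys\<close> by adjacent swaps,
  each of which costs a factor \<open>-1\<close>.\<close>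

lemma alternating_form_move:
  assumes vs: "vector_space scale" and alt: "alternating_form scale n D"
    and "length (xs @ ys @ f # zs) = n"
    and "set (xs @ ys @ f # zs) \<subseteq> dual_space scale"
  shows "D (xs @ ys @ f # zs) = (-1) ^ length ys * D (xs @ f # ys @ zs)"
  using assms(3,4)
proof (induction ys arbitrary: xs)
  case Nil
  then show ?case by simp
next
  case (Cons y ys)
  have "D (xs @ (y # ys) @ f # zs) = D ((xs @ [y]) @ ys @ f # zs)"
    by simp
  also have "\<dots> = (-1) ^ length ys * D ((xs @ [y]) @ f # ys @ zs)"
    using Cons.prems by (intro Cons.IH) auto
  also have "D ((xs @ [y]) @ f # ys @ zs) = - D (xs @ f # y # ys @ zs)"
    using alternating_form_swap[OF vs alt, of xs y f "ys @ zs"] Cons.prems by simp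
  finally show ?case by simp
qed

text \<open>Tracking nonvanishing alone avoids the sign of a permutation. The next index of
  \<open>ms\<close> is located in \<open>ks\<close>, moved to its front and absorbed into the prefix
  \<open>xs\<close>.\<close>

lemma alternating_form_rearrange:
  assumes vs: "vector_space scale" and alt: "alternating_form scale n D"
    and "distinct ks" "distinct ms" "set ks = set ms"
    and "length xs + length ks = n"
    and "set xs \<subseteq> dual_space scale" "a ` set ks \<subseteq> dual_space scale"
    and "D (xs @ map a ks) \<noteq> 0"
  shows "D (xs @ map a ms) \<noteq> 0"
  using assms(3-)
proof (induction ms arbitrary: xs ks)
  case Nil
  then show ?case by simp
next
  case (Cons m ms)
  then obtain us vs where ks: "ks = us @ m # vs"
    by (metis list.set_intros(1) split_list)
  have "D (xs @ map a us @ a m # map a vs) =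
      (-1) ^ length (map a us) * D (xs @ a m # map a us @ map a vs)"
  proof (rule alternating_form_move[OF vs alt])
    have "set (map a ks) \<subseteq> dual_space scale"
      using Cons.prems by simp
    then show "set (xs @ map a us @ a m # map a vs) \<subseteq> dual_space scale"
      using Cons.prems by (simp add: ks)
  qed (use Cons.prems in \<open>simp add: ks\<close>)
  then have nz: "D ((xs @ [a m]) @ map a (us @ vs)) \<noteq> 0"
    using Cons.prems by (auto simp: ks)
  have "D ((xs @ [a m]) @ map a ms) \<noteq> 0"
  proof (rule Cons.IH[OF _ _ _ _ _ _ nz])
    show eq: "set (us @ vs) = set ms"
      using Cons.prems(1-3) by (auto simp: ks)
    show "a ` set (us @ vs) \<subseteq> dual_space scale"
      unfolding eq using Cons.prems by auto
  qed (use Cons.prems in \<open>auto simp: ks\<close>)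
  then show ?case by simp
qed

text \<open>The entries of \<open>ys\<close> are exchanged for spanning forms one at a time. If
  every exchange in a slot gave zero, linearity would give zero for the original entry as
  well.\<close>

lemma alternating_form_spanning_nonzero:
  assumes vs: "vector_space scale" and alt: "alternating_form scale n D"
    and span: "fun_space.span (a ` A) = dual_space scale"
    and "length xs + length ys = n"
    and "set xs \<subseteq> dual_space scale" "set ys \<subseteq> dual_space scale"
    and "D (xs @ ys) \<noteq> 0"
  shows "\<exists>ks. length ks = length ys \<and> set ks \<subseteq> A \<and> D (xs @ map a ks) \<noteq> 0"
  using assms(4-)
proof (induction ys arbitrary: xs)
  case Nil
  then show ?case by auto
next
  case (Cons y ys)
  have len: "Suc (length xs + length ys) = n" and ys: "set ys \<subseteq> dual_space scale"
    using Cons.prems by auto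
  have a: "a k \<in> dual_space scale" if "k \<in> A" for k
    using that span fun_space.span_base[of "a k" "a ` A"] by auto
  have "\<exists>k\<in>A. D (xs @ a k # ys) \<noteq> 0"
  proof (rule ccontr)
    assume "\<not> ?thesis"
    then have z: "D (xs @ a k # ys) = 0" if "k \<in> A" for k
      using that by blast
    have "y \<in> fun_space.span (a ` A)"
      using span Cons.prems by auto
    \<comment> \<open>Membership in the dual space is carried through the induction because
      \<open>D\<close> is additive only on linear forms.\<close>
    then have "y \<in> dual_space scale \<and> D (xs @ y # ys) = 0"
    proof (induction rule: fun_space.span_induct_alt)
      case base
      show "0 \<in> dual_space scale \<and> D (xs @ 0 # ys) = 0"
        using alternating_form_zero[OF vs alt len Cons.prems(2) ys]
          fun_space.subspace_0[OF dual_space_subspace[OF vs]] by simp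
    next
      case (step c x y)
      then obtain k where k: "k \<in> A" "x = a k" by auto
      have cx: "fun_scale c x \<in> dual_space scale"
        using a[OF k(1)] k(2) by (auto intro: fun_space.subspace_scale[OF dual_space_subspace[OF vs]])
      then show "fun_scale c x + y \<in> dual_space scale \<and> D (xs @ (fun_scale c x + y) # ys) = 0"
        using step a[OF k(1)] k(2) z[OF k(1)]
          alternating_form_add[OF alt len Cons.prems(2) ys cx, of y]
          alternating_form_scale[OF alt len Cons.prems(2) ys, of x c]
        by (auto intro: fun_space.subspace_add[OF dual_space_subspace[OF vs]])
    qed
    then show False
      using Cons.prems by simp
  qed
  then obtain k where k: "k \<in> A" "D (xs @ a k # ys) \<noteq> 0" by blast
  have "\<exists>ks. length ks = length ys \<and> set ks \<subseteq> A \<and> D ((xs @ [a k]) @ map a ks) \<noteq> 0"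
    using k a Cons.prems by (intro Cons.IH) auto
  then obtain ks where "length ks = length ys" "set ks \<subseteq> A" "D ((xs @ [a k]) @ map a ks) \<noteq> 0"
    by blast
  then show ?case
    using k(1) by (intro exI[of _ "k # ks"]) auto
qed

text \<open>After the zero form, written as the relation, replaces \<open>a k\<close> in the list
  omitting \<open>j\<close>, every term except those for \<open>j\<close> and \<open>k\<close> has a
  repeated entry. The term for \<open>k\<close> is the original list; the one for \<open>j\<close>
  becomes the list omitting \<open>k\<close> once \<open>a j\<close> is moved past the entries
  between.\<close>

lemma alternating_form_omit_relation:
  assumes vs: "vector_space scale" and alt: "alternating_form scale n D"
    and a: "\<And>i. i \<le> n \<Longrightarrow> a i \<in> dual_space scale"
    and rel: "(\<Sum>i\<le>n. fun_scale (l i) (a i)) = 0"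
    and jk: "j < k" "k \<le> n"
  shows "l k * ((-1) ^ j * D (omit n a j)) = l j * ((-1) ^ k * D (omit n a k))"
proof -
  define A where "A = map a [0..<j]"
  define B where "B = map a [Suc j..<k]"
  define C where "C = map a [Suc k..<Suc n]"
  have split: "[Suc j..<Suc n] = [Suc j..<k] @ k # [Suc k..<Suc n]" "[0..<k] = [0..<j] @ j # [Suc j..<k]"
    using jk upt_add_eq_append[of "Suc j" k "Suc n - k"] upt_add_eq_append[of 0 j "k - j"]
    by (simp_all add: upt_conv_Cons del: upt_Suc)
  have oj: "omit n a j = A @ B @ a k # C" and ok: "omit n a k = A @ a j # B @ C"
    by (simp_all add: omit_def split A_def B_def C_def del: upt_Suc)
  have len: "Suc (length (A @ B) + length C) = n"
    using jk by (auto simp: A_def B_def C_def simp del: upt_Suc)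
  have subs: "set A \<subseteq> dual_space scale" "set B \<subseteq> dual_space scale" "set C \<subseteq> dual_space scale"
    using a jk by (auto simp: A_def B_def C_def simp del: upt_Suc)
  have sub: "set (A @ B) \<subseteq> dual_space scale"
    using subs by simp
  have rep: "D ((A @ B) @ a i # C) = 0" if "i \<le> n" "i \<noteq> j" "i \<noteq> k" for i
  proof (rule alternating_form_repeated[OF alt len sub subs(3) a[OF that(1)]])
    have "i \<in> {0..<j} \<union> {Suc j..<k} \<union> {Suc k..<Suc n}"
      using that by auto
    then show "a i \<in> set (A @ B) \<union> set C"
      by (auto simp: A_def B_def C_def simp del: upt_Suc)
  qed
  have "0 = D ((A @ B) @ (\<Sum>i\<le>n. fun_scale (l i) (a i)) # C)"
    unfolding rel using alternating_form_zero[OF vs alt len sub subs(3)] by simp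
  also have "\<dots> = (\<Sum>i\<le>n. l i * D ((A @ B) @ a i # C))"
    by (rule alternating_form_sum[OF vs alt len sub subs(3)]) (use a in auto)
  also have "\<dots> = (\<Sum>i\<in>{j, k}. l i * D ((A @ B) @ a i # C))"
    using jk rep by (intro sum.mono_neutral_right) auto
  also have "\<dots> = l j * D (A @ B @ a j # C) + l k * D (omit n a j)"
    using jk by (simp add: oj)
  also have "D (A @ B @ a j # C) = (-1) ^ length B * D (omit n a k)"
    unfolding ok using a jk subs len by (intro alternating_form_move[OF vs alt]) auto
  finally have *: "l k * D (omit n a j) = - (l j * ((-1) ^ length B * D (omit n a k)))"
    by simp
  \<comment> \<open>\<open>length B\<close> is \<open>k - j - 1\<close>, not \<open>k - j\<close>.
    The extra sign cancels the minus in \<open>*\<close>.\<close>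
  have "(-1 :: rat) ^ k = (-1) ^ Suc (j + length B)"
    using jk by (simp add: B_def)
  then have sign: "(-1 :: rat) ^ k = - ((-1) ^ j * (-1) ^ length B)"
    by (simp add: power_add)
  have "l k * ((-1) ^ j * D (omit n a j)) = (-1) ^ j * (l k * D (omit n a j))"
    by simp
  also have "\<dots> = l j * ((-1) ^ k * D (omit n a k))"
    unfolding * sign by simp
  finally show ?thesis .
qed

text \<open>A nonzero value of \<open>D\<close> can be realized on \<open>n\<close> of the spanning
  forms. Their indices are distinct, since a repetition would give zero, so exactly one of the
  \<open>n + 1\<close> indices is missing, and sorting the others preserves nonvanishing.\<close>

lemma omit_nonzero:
  assumes vs: "vector_space scale" and alt: "alternating_form scale n D" and nz: "nonzero_form scale n D"
    and span: "fun_space.span (a ` {..n}) = dual_space scale"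
  obtains m where "m \<le> n" "D (omit n a m) \<noteq> 0"
proof -
  obtain bs where bs: "length bs = n" "set bs \<subseteq> dual_space scale" "D bs \<noteq> 0"
    using nz unfolding nonzero_form_def by blast
  obtain ks where ks: "length ks = n" "set ks \<subseteq> {..n}" "D (map a ks) \<noteq> 0"
    using alternating_form_spanning_nonzero[OF vs alt span, of "[]" bs] bs 
    by (metis append_Nil list.set(1) empty_subsetI list.size(3) add_0)
  have a: "a k \<in> dual_space scale" if "k \<le> n" for k
    using that span fun_space.span_base[of "a k" "a ` {..n}"] by auto
  have dist: "distinct ks"
  proof (rule ccontr)
    assume "\<not> distinct ks"
    then obtain us x vs' ws where "ks = us @ [x] @ vs' @ [x] @ ws"
      using not_distinct_decomp by blast
    moreover have "set (map a ks) \<subseteq> dual_space scale"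
      using ks(2) a by auto
    ultimately have "D (map a us @ a x # map a vs' @ a x # map a ws) = 0"
      using ks(1) by (intro alternating_form_repeated[OF alt]) simp_all
    then show False
      using ks(3) \<open>ks = _\<close> by simp
  qed
  have "card (set ks) = n"
    using dist ks(1) by (simp add: distinct_card)
  then have "card ({..n} - set ks) = 1"
    using ks(2) by (simp add: card_Diff_subset)
  then obtain m where "{..n} - set ks = {m}"
    using card_1_singletonE by blast
  then have m: "m \<le> n" "set ks = {..n} - {m}"
    using ks(2) by auto
  have seq: "set ks = set ([0..<m] @ [Suc m..<Suc n])"
    unfolding m(2) set_append set_upt using m(1) by auto
  have dseq: "distinct ([0..<m] @ [Suc m..<Suc n])"
    unfolding distinct_append set_upt by auto
  have sub: "a ` set ks \<subseteq> dual_space scale"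
    using ks(2) a by auto
  have "D ([] @ map a ([0..<m] @ [Suc m..<Suc n])) \<noteq> 0"
    by (rule alternating_form_rearrange[OF vs alt dist dseq seq _ _ sub]) (use ks in simp_all)
  then show thesis
    using that[OF m(1)] unfolding omit_def append_Nil by blast
qed

lemma omit_sign_eq_sgn:
  assumes vs: "vector_space scale" and alt: "alternating_form scale n D" and nz: "nonzero_form scale n D"
    and span: "fun_space.span (a ` {..n}) = dual_space scale"
    and rel: "(\<Sum>i\<le>n. fun_scale (l i) (a i)) = 0"
    and l: "\<exists>k\<le>n. l k \<noteq> 0"
  obtains e where "e \<in> {-1, 1}" "\<And>j. j \<le> n \<Longrightarrow> omit_sign D n a j = e * sgn (l j)"
proof -
  \<comment> \<open>The signed determinants satisfy the same proportions as the coefficients of the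
    relation, as in Cramer's rule. Both families are nonzero, so they differ by a nonzero factor
    \<kappa>, whose sign is \<open>e\<close>.\<close>
  define \<mu> where "\<mu> j = (-1) ^ j * D (omit n a j)" for j
  have a: "a k \<in> dual_space scale" if "k \<le> n" for k
    using that span fun_space.span_base[of "a k" "a ` {..n}"] by auto
  have cross: "l k * \<mu> j = l j * \<mu> k" if "j \<le> n" "k \<le> n" for j k
    using alternating_form_omit_relation[OF vs alt a rel, of j k]
      alternating_form_omit_relation[OF vs alt a rel, of k j] that
    unfolding \<mu>_def by (cases j k rule: linorder_cases) auto
  obtain m where m: "m \<le> n" "D (omit n a m) \<noteq> 0"
    by (rule omit_nonzero[OF vs alt nz span])
  obtain k where k: "k \<le> n" "l k \<noteq> 0"
    using l by blast
  have mm: "\<mu> m \<noteq> 0"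
    using m by (simp add: \<mu>_def)
  \<comment> \<open>Otherwise the proportion between \<open>m\<close> and \<open>k\<close> would
    read \<open>l k * \<mu> m = 0\<close>, with both factors nonzero.\<close>
  have lm: "l m \<noteq> 0"
    using cross[OF m(1) k(1)] k(2) mm by auto
  define \<kappa> where "\<kappa> = \<mu> m / l m"
  have "\<mu> j = \<kappa> * l j" if "j \<le> n" for j
    using cross[OF that m(1)] lm by (simp add: \<kappa>_def field_simps)
  moreover have "omit_sign D n a j = sgn (\<mu> j)" for j
    by (cases "even j") (simp_all add: omit_sign_def \<mu>_def sgn_mult)
  ultimately have "omit_sign D n a j = sgn \<kappa> * sgn (l j)" if "j \<le> n" for j
    using that by (simp add: sgn_mult)
  moreover have "sgn \<kappa> \<in> {-1, 1}"
    using mm lm by (auto simp: \<kappa>_def sgn_if)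
  ultimately show thesis
    using that by blast
qed

section \<open>Cones\<close>

text \<open>Indexing by a set turns the omission of any number of forms into a set
  difference.\<close>

definition dual_cone :: "(nat \<Rightarrow> 'v \<Rightarrow> rat) \<Rightarrow> nat set \<Rightarrow> 'v set" where
  "dual_cone a J = {v. \<forall>i\<in>J. 0 \<le> a i v}"

lemma dual_cone_indicator_omit:
  "j \<le> n \<Longrightarrow> dual_cone_indicator (omit n a j) = indicator (dual_cone a ({..n} - {j}))"
proof -
  assume "j \<le> n"
  then have "{0..<j} \<union> {Suc j..<Suc n} = {..n} - {j}"
    by auto
  then have "set (omit n a j) = a ` ({..n} - {j})"
    unfolding omit_def by (simp del: upt_Suc flip: image_Un)
  then show ?thesis
    by (simp add: dual_cone_indicator_def dual_cone_def)
qed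

text \<open>Coefficients may be indexed by the elements of \<open>ks\<close> instead of by list
  positions, since the two correspond bijectively for a distinct list.\<close>

lemma generated_cone_map:
  assumes "distinct ks"
  shows "generated_cone scale (map w ks) [] =
    {\<Sum>k\<in>set ks. scale (s k) (w k) | s. \<forall>k\<in>set ks. 0 \<le> s k}" (is "?L = ?R")
proof -
  have bij: "bij_betw ((!) ks) {..<length ks} (set ks)"
    using assms by (simp add: bij_betw_nth)
  have re: "(\<Sum>i<length ks. scale (s (ks ! i)) (w (ks ! i))) = (\<Sum>k\<in>set ks. scale (s k) (w k))" for s
    by (rule sum.reindex_bij_betw[OF bij, of "\<lambda>k. scale (s k) (w k)"])
  show ?thesis
  proof (intro equalityI subsetI)
    fix v assume "v \<in> ?L"
    then obtain s where s: "v = (\<Sum>i<length ks. scale (s i) (w (ks ! i)))" "\<forall>i<length ks. 0 \<le> s i"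
      by (auto simp: generated_cone_def)
    define s' where "s' = s \<circ> inv_into {..<length ks} ((!) ks)"
    have s': "s' (ks ! i) = s i" if "i < length ks" for i
      using bij that by (simp add: s'_def bij_betw_def)
    then have "\<forall>k\<in>set ks. 0 \<le> s' k"
      using s(2) by (auto simp: in_set_conv_nth)
    moreover have "v = (\<Sum>k\<in>set ks. scale (s' k) (w k))"
      unfolding re[symmetric] s(1) by (intro sum.cong) (auto simp: s')
    ultimately show "v \<in> ?R" by blast
  next
    fix v assume "v \<in> ?R"
    then obtain s where s: "v = (\<Sum>k\<in>set ks. scale (s k) (w k))" "\<forall>k\<in>set ks. 0 \<le> s k"
      by blast
    then show "v \<in> ?L"
      unfolding generated_cone_def re[symmetric]
      by (auto intro!: exI[of _ "\<lambda>i. s (ks ! i)"])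
  qed
qed

text \<open>In the coordinates given by the dual basis \<open>w\<close>, the cone constrains the
  coordinates in \<open>J\<close> to be nonnegative and leaves the others free. Each free coordinate
  gives a line.\<close>

lemma closed_polyhedral_dual_cone:
  assumes vs: "vector_space scale" and I: "finite I" "J \<subseteq> I"
    and a: "\<And>i. i \<in> I \<Longrightarrow> a i \<in> dual_space scale"
    and dual: "\<And>i k. i \<in> I \<Longrightarrow> k \<in> I \<Longrightarrow> a i (w k) = (if i = k then 1 else 0)"
    and expand: "\<And>v. v = (\<Sum>i\<in>I. scale (a i v) (w i))"
  shows "closed_polyhedral_cone scale (dual_cone a J)"
    and "J \<noteq> I \<Longrightarrow> contains_line scale (dual_cone a J)"
proof -
  interpret vector_space scale by fact
  define K where "K = {(i, b). i \<in> I \<and> (b \<or> i \<notin> J)}"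
  define x where "x = (\<lambda>(i, b). if b then w i else - w i)"
  have "K \<subseteq> I \<times> UNIV"
    by (auto simp: K_def)
  then have finK: "finite K"
    using I(1) by (auto intro: finite_subset)
  then obtain ks where ks: "set ks = K" "distinct ks"
    using finite_distinct_list by blast
  have w0: "w i \<noteq> 0" if "i \<in> I" for i
    using dual[OF that that] dual_zero[OF vs a[OF that]] by auto
  have "dual_cone a J = generated_cone scale (map x ks) []"
    unfolding generated_cone_map[OF ks(2)] ks(1)
  proof (intro equalityI subsetI)
    fix v assume v: "v \<in> dual_cone a J"
    \<comment> \<open>The positive and negative parts of the coordinates. On the cone the negative
      part vanishes for \<open>i\<close> in \<open>J\<close>, exactly where \<open>- w i\<close> is
      missing from \<open>K\<close>.\<close>
    define s where "s = (\<lambda>(i, b). if b then max 0 (a i v) else max 0 (- a i v))"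
    have "v = (\<Sum>i\<in>I. scale (a i v) (w i))"
      by (rule expand)
    also have "\<dots> = (\<Sum>i\<in>I. \<Sum>b\<in>UNIV. scale (s (i, b)) (x (i, b)))"
      by (intro sum.cong) (auto simp: UNIV_bool s_def x_def max_def)
    also have "\<dots> = (\<Sum>k\<in>I \<times> UNIV. scale (s k) (x k))"
      by (simp add: sum.cartesian_product case_prod_beta)
    also have "\<dots> = (\<Sum>k\<in>K. scale (s k) (x k))"
      using v I(1) by (intro sum.mono_neutral_right) (auto simp: K_def s_def dual_cone_def)
    finally have "v = (\<Sum>k\<in>K. scale (s k) (x k))" .
    moreover have "\<forall>k\<in>K. 0 \<le> s k"
      by (auto simp: s_def)
    ultimately show "v \<in> {\<Sum>k\<in>K. scale (s k) (x k) | s. \<forall>k\<in>K. 0 \<le> s k}"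
      by blast
  next
    fix v assume "v \<in> {\<Sum>k\<in>K. scale (s k) (x k) | s. \<forall>k\<in>K. 0 \<le> s k}"
    then obtain s where s: "v = (\<Sum>k\<in>K. scale (s k) (x k))" "\<forall>k\<in>K. 0 \<le> s k"
      by blast
    have "0 \<le> a i v" if "i \<in> J" for i
    proof -
      have i: "i \<in> I"
        using that I by auto
      have "a i v = (\<Sum>k\<in>K. s k * a i (x k))"
        unfolding s(1) by (simp add: dual_sum[OF vs a[OF i]] dual_scale[OF vs a[OF i]])
      \<comment> \<open>For \<open>i\<close> in \<open>J\<close>, the form \<open>a i\<close> is
        \<open>1\<close> on \<open>w i\<close> and \<open>0\<close> on all other generators.\<close>
      also have "\<dots> \<ge> 0"
        using s(2) that
        by (intro sum_nonneg mult_nonneg_nonneg)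
          (auto simp: K_def x_def dual[OF i] dual_minus[OF vs a[OF i]])
      finally show ?thesis .
    qed
    then show "v \<in> dual_cone a J"
      by (simp add: dual_cone_def)
  qed
  moreover have "0 \<notin> set (map x ks)"
    using w0 by (auto simp: ks(1) K_def x_def split: if_splits)
  ultimately show "closed_polyhedral_cone scale (dual_cone a J)"
    unfolding closed_polyhedral_cone_def by blast
  assume "J \<noteq> I"
  then obtain i where i: "i \<in> I" "i \<notin> J"
    using I(2) by blast
  have "a k (scale t (w i)) = 0" if "k \<in> J" for k t
    using dual[of k i] i that I(2) dual_scale[OF vs a] by (auto simp: subset_iff)
  then show "contains_line scale (dual_cone a J)"
    unfolding contains_line_def dual_cone_def using w0[OF i(1)] by (intro exI[of _ "w i"]) auto
qed

text \<open>All forms but \<open>a k\<close> have a common nonzero zero, being fewer than the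
  dimension. By separation \<open>a k\<close> does not vanish there, so rescaling gives
  \<open>w k\<close>. The expansion holds because both sides agree under every form.\<close>

lemma dual_basis_exists:
  fixes a :: "'i \<Rightarrow> 'v::ab_group_add \<Rightarrow> rat"
  assumes vs: "vector_space scale"
    and I: "finite I" "card I = vector_space.dim scale (UNIV :: 'v set)"
    and a: "\<And>i. i \<in> I \<Longrightarrow> a i \<in> dual_space scale"
    and sep: "\<And>v. (\<And>i. i \<in> I \<Longrightarrow> a i v = 0) \<Longrightarrow> v = 0"
  obtains w where "\<And>i k. i \<in> I \<Longrightarrow> k \<in> I \<Longrightarrow> a i (w k) = (if i = k then 1 else 0)"
    and "\<And>v. v = (\<Sum>i\<in>I. scale (a i v) (w i))"
proof -
  have "\<exists>u. \<forall>i\<in>I. a i u = (if i = k then 1 else 0)" if k: "k \<in> I" for k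
  proof -
    have "card (I - {k}) < vector_space.dim scale (UNIV :: 'v set)"
      using I k by (metis card_Diff1_less)
    then obtain u where u: "u \<noteq> 0" "\<And>i. i \<in> I - {k} \<Longrightarrow> a i u = 0"
      using exists_common_zero[OF vs, of "I - {k}" a] I(1) a by auto
    then have "a k u \<noteq> 0"
      using sep[of u] by blast
    then show ?thesis
      using u by (intro exI[of _ "scale (1 / a k u) u"]) (auto simp: dual_scale[OF vs a])
  qed
  then obtain w where w: "\<And>i k. i \<in> I \<Longrightarrow> k \<in> I \<Longrightarrow> a i (w k) = (if i = k then 1 else 0)"
    by metis
  have "v = (\<Sum>i\<in>I. scale (a i v) (w i))" for v
  proof -
    have "v - (\<Sum>i\<in>I. scale (a i v) (w i)) = 0"
    proof (rule sep)
      fix k assume k: "k \<in> I"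
      have "a k (\<Sum>i\<in>I. scale (a i v) (w i)) = (\<Sum>i\<in>I. a i v * (if k = i then 1 else 0))"
        by (simp add: dual_sum[OF vs a[OF k]] dual_scale[OF vs a[OF k]] w k cong: sum.cong)
      also have "\<dots> = a k v"
        using I(1) k by (simp add: if_distrib cong: if_cong)
      finally show "a k (v - (\<Sum>i\<in>I. scale (a i v) (w i))) = 0"
        by (simp add: dual_diff[OF vs a[OF k]])
    qed
    then show ?thesis by simp
  qed
  with w show thesis
    using that by blast
qed

text \<open>A nonzero vector is detected by some linear form, but a combination of the
  \<open>a i\<close> vanishes wherever they all do.\<close>

lemma spanning_forms_separate:
  assumes vs: "vector_space scale"
    and span: "fun_space.span (a ` A) = dual_space scale"
    and zero: "\<And>i. i \<in> A \<Longrightarrow> a i v = 0"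
  shows "v = 0"
proof (rule ccontr)
  assume "v \<noteq> 0"
  then obtain f where f: "f \<in> dual_space scale" "f v \<noteq> 0"
    by (rule exists_dual_nonzero[OF vs])
  from f(1) have "f \<in> fun_space.span (a ` A)"
    by (simp add: span)
  then have "f v = 0"
    by (induction rule: fun_space.span_induct_alt) (auto simp: zero)
  then show False
    using f(2) by simp
qed

lemma relation_apply:
  assumes "(\<Sum>i\<le>n. fun_scale (l i) (a i)) = 0"
  shows "(\<Sum>i\<le>n. l i * a i v) = 0"
  using fun_cong[OF assms, of v] by (simp add: sum_fun_apply)

text \<open>Since \<open>l k\<close> is nonzero, the relation recovers \<open>a k\<close> from the
  other \<open>n\<close> forms, which therefore still separate vectors and admit a dual
  basis.\<close>

lemma dual_cone_subset_omit:
  fixes a :: "nat \<Rightarrow> 'v::ab_group_add \<Rightarrow> rat"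
  assumes vs: "vector_space scale"
    and dim: "vector_space.dim scale (UNIV :: 'v set) = n"
    and span: "fun_space.span (a ` {..n}) = dual_space scale"
    and rel: "(\<Sum>i\<le>n. fun_scale (l i) (a i)) = 0"
    and k: "k \<le> n" "l k \<noteq> 0"
    and J: "J \<subseteq> {..n} - {k}"
  shows "closed_polyhedral_cone scale (dual_cone a J)"
    and "J \<noteq> {..n} - {k} \<Longrightarrow> contains_line scale (dual_cone a J)"
proof -
  let ?I = "{..n} - {k}"
  have a: "a i \<in> dual_space scale" if "i \<in> ?I" for i
    using that span fun_space.span_base[of "a i" "a ` {..n}"] by auto
  have sep: "v = 0" if z: "\<And>i. i \<in> ?I \<Longrightarrow> a i v = 0" for v
  proof (rule spanning_forms_separate[OF vs span])
    have "(\<Sum>i\<le>n. l i * a i v) = l k * a k v + (\<Sum>i\<in>?I. l i * a i v)"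
      using k(1) by (simp add: sum.remove)
    then have "a k v = 0"
      using relation_apply[OF rel, of v] z k(2) by simp
    then show "a i v = 0" if "i \<in> {..n}" for i
      using z that by (cases "i = k") auto
  qed
  have card: "card ?I = vector_space.dim scale (UNIV :: 'v set)"
    using k(1) dim by simp
  obtain w where w: "\<And>i m. i \<in> ?I \<Longrightarrow> m \<in> ?I \<Longrightarrow> a i (w m) = (if i = m then 1 else 0)"
    "\<And>v. v = (\<Sum>i\<in>?I. scale (a i v) (w i))"
    using dual_basis_exists[where a = a, OF vs _ card a sep] by blast
  note cone = closed_polyhedral_dual_cone[OF vs _ J a w]
  show "closed_polyhedral_cone scale (dual_cone a J)"
    by (rule cone(1)) auto
  show "contains_line scale (dual_cone a J)" if "J \<noteq> ?I"
    by (rule cone(2)) (use that in auto)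
qed

section \<open>Inclusion-exclusion modulo cones with lines\<close>

lemma line_subspace_subspace: "fun_space.subspace (line_subspace scale)"
  by (simp add: line_subspace_def)

lemma indicator_dual_cone:
  "finite J \<Longrightarrow> (indicator (dual_cone a J) v :: rat) = (\<Prod>i\<in>J. of_bool (0 \<le> a i v))"
  by (induction J rule: finite_induct) (auto simp: dual_cone_def indicator_def)

lemma sum_omit_cones_mod_lines:
  fixes a :: "nat \<Rightarrow> 'v::ab_group_add \<Rightarrow> rat"
  assumes vs: "vector_space scale"
    and dim: "vector_space.dim scale (UNIV :: 'v set) = n"
    and span: "fun_space.span (a ` {..n}) = dual_space scale"
    and rel: "(\<Sum>i\<le>n. fun_scale (l i) (a i)) = 0"
    and P: "P \<subseteq> {..n}" "P \<noteq> {}"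
    and pos: "\<And>i. i \<in> P \<Longrightarrow> 0 < l i"
    and nonpos: "\<And>i. i \<in> {..n} - P \<Longrightarrow> l i \<le> 0"
  shows "(\<Sum>j\<in>P. indicator (dual_cone a ({..n} - {j}))) - indicator (dual_cone a {..n})
    \<in> line_subspace scale"
proof -
  define c where "c T = (indicator (dual_cone a ({..n} - T)) :: 'v \<Rightarrow> rat)" for T
  define R where "R = {T \<in> Pow P. 2 \<le> card T}"
  have finP: "finite P"
    using P(1) finite_subset by blast
  have c_line: "c T \<in> line_subspace scale" if T: "T \<in> R" for T
  proof -
    have "\<not> card T \<le> Suc 0" "finite T"
      using T finP by (auto simp: R_def intro: finite_subset)
    \<comment> \<open>Omitting \<open>k\<close> alone leaves a basis of the dual space, because
      \<open>l k\<close> is positive. Omitting \<open>m\<close> as well frees a coordinate and so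
      yields a line.\<close>
    then obtain k m where km: "k \<in> T" "m \<in> T" "k \<noteq> m"
      using card_le_Suc0_iff_eq by blast
    then have k: "k \<le> n" "l k \<noteq> 0" and m: "m \<in> {..n} - {k}"
      using T P(1) pos[of k] by (auto simp: R_def)
    have "{..n} - T \<subseteq> {..n} - {k}" "{..n} - T \<noteq> {..n} - {k}"
      using km m by auto
    then show ?thesis
      using dual_cone_subset_omit[OF vs dim span rel k, of "{..n} - T"]
      unfolding c_def line_subspace_def by (intro fun_space.span_base) auto
  qed
  have "(\<Sum>T\<in>Pow P. (-1) ^ card T * c T v) = 0" for v
  proof -
    let ?x = "\<lambda>i. of_bool (0 \<le> a i v) :: rat"
    \<comment> \<open>At such a point the relation would take a negative value: strictly negative
      terms over the nonempty \<open>P\<close>, and nonpositive ones elsewhere.\<close>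
    have "\<not> ((\<forall>i\<in>P. a i v < 0) \<and> (\<forall>i\<in>{..n} - P. 0 \<le> a i v))"
    proof
      assume *: "(\<forall>i\<in>P. a i v < 0) \<and> (\<forall>i\<in>{..n} - P. 0 \<le> a i v)"
      have "(\<Sum>i\<le>n. l i * a i v) = (\<Sum>i\<in>P. l i * a i v) + (\<Sum>i\<in>{..n} - P. l i * a i v)"
        using P(1) by (simp add: sum.subset_diff add.commute)
      moreover have "(\<Sum>i\<in>P. l i * a i v) < (\<Sum>i\<in>P. 0)"
        using * pos P(2) finP by (intro sum_strict_mono) (auto intro: mult_pos_neg)
      moreover have "(\<Sum>i\<in>{..n} - P. l i * a i v) \<le> 0"
        using * nonpos by (intro sum_nonpos mult_nonpos_nonneg) auto
      ultimately show False
        using relation_apply[OF rel, of v] by simp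
    qed
    then have "(\<Prod>i\<in>P. ?x i - 1) * (\<Prod>i\<in>{..n} - P. ?x i) = 0"
      using finP by (auto simp: prod_zero_iff not_less)
    also have "(\<Prod>i\<in>P. ?x i - 1) = (\<Sum>T\<in>Pow P. (-1) ^ card T * (\<Prod>i\<in>P - T. ?x i))"
      using finP by (simp add: prod_diff_conv_sum)
    finally have "0 = (\<Sum>T\<in>Pow P. (-1) ^ card T * ((\<Prod>i\<in>P - T. ?x i) * (\<Prod>i\<in>{..n} - P. ?x i)))"
      by (simp add: sum_distrib_right mult.assoc)
    also have "\<dots> = (\<Sum>T\<in>Pow P. (-1) ^ card T * c T v)"
    proof (rule sum.cong[OF refl])
      fix T assume "T \<in> Pow P"
      then have "{..n} - T = (P - T) \<union> ({..n} - P)"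
        using P(1) by auto
      then have "c T v = (\<Prod>i\<in>P - T. ?x i) * (\<Prod>i\<in>{..n} - P. ?x i)"
        unfolding c_def using finP
        by (subst indicator_dual_cone, simp, simp only:, subst prod.union_disjoint) auto
      then show "(-1) ^ card T * ((\<Prod>i\<in>P - T. ?x i) * (\<Prod>i\<in>{..n} - P. ?x i)) = (-1) ^ card T * c T v"
        by simp
    qed
    finally show ?thesis by simp
  qed
  \<comment> \<open>The expansion is sorted by the number of omitted forms: none, one, or at least
    two.\<close>
  moreover have "Pow P = insert {} ((\<lambda>j. {j}) ` P \<union> R)"
  proof -
    have "T = {} \<or> T \<in> (\<lambda>j. {j}) ` P \<or> T \<in> R" if T: "T \<in> Pow P" for T
    proof -
      have "finite T"
        using T finP finite_subset by auto
      then consider "T = {}" | "card T = 1" | "2 \<le> card T"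
        by (metis One_nat_def Suc_1 Suc_leI card_gt_0_iff le_neq_implies_less less_Suc_eq_0_disj neq0_conv)
      then show ?thesis
        using T by cases (auto simp: R_def card_1_singleton_iff)
    qed
    then show ?thesis by (auto simp: R_def)
  qed
  moreover have "(\<Sum>T\<in>insert {} ((\<lambda>j. {j}) ` P \<union> R). (-1) ^ card T * c T v) =
      c {} v - (\<Sum>j\<in>P. c {j} v) + (\<Sum>T\<in>R. (-1) ^ card T * c T v)" for v
  proof -
    have "finite R"
      using finP by (simp add: R_def)
    moreover have "(\<Sum>T\<in>(\<lambda>j. {j}) ` P. (-1) ^ card T * c T v) = - (\<Sum>j\<in>P. c {j} v)"
      by (subst sum.reindex) (auto simp: sum_negf)
    ultimately show ?thesis
      using finP by (subst sum.insert, (auto simp: R_def)[2], subst sum.union_disjoint) (auto simp: R_def)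
  qed
  ultimately have "(\<Sum>j\<in>P. c {j}) - c {} = (\<Sum>T\<in>R. fun_scale ((-1) ^ card T) (c T))"
    by (simp add: fun_eq_iff sum_fun_apply algebra_simps)
  also have "\<dots> \<in> line_subspace scale"
    by (intro fun_space.subspace_sum[OF line_subspace_subspace]
        fun_space.subspace_scale[OF line_subspace_subspace] c_line)
  finally show ?thesis
    by (simp add: c_def)
qed

section \<open>Membership in the algebra of cone functions\<close>

lemma zero_in_cone_algebra: "0 \<in> cone_algebra scale"
proof -
  have "polyhedral_cone scale (generated_cone scale [] [])"
    unfolding polyhedral_cone_def by (intro exI[of _ "[]"]) simp
  from cone_algebra.scale[OF cone_algebra.indicator[OF this], of 0]
  show ?thesis by (simp add: fun_space.scale_zero_left)
qed

lemma sum_in_cone_algebra: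
  "(\<And>i. i \<in> A \<Longrightarrow> f i \<in> cone_algebra scale) \<Longrightarrow> sum f A \<in> cone_algebra scale"
  by (induction A rule: infinite_finite_induct)
    (auto simp: zero_in_cone_algebra intro: cone_algebra.add)

lemma delta_in_cone_algebra: "indicator {0} \<in> cone_algebra scale"
proof -
  have "generated_cone scale [] [] = {0}"
    by (auto simp: generated_cone_def)
  then have "polyhedral_cone scale {0}"
    unfolding polyhedral_cone_def by (metis empty_iff list.set(1))
  then show ?thesis
    by (rule cone_algebra.indicator)
qed

lemma indicator_closed_cone_in_cone_algebra:
  "closed_polyhedral_cone scale C \<Longrightarrow> indicator C \<in> cone_algebra scale"
  unfolding closed_polyhedral_cone_def
  by (rule cone_algebra.indicator) (metis polyhedral_cone_def empty_iff list.set(1))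

section \<open>The two congruences, from the signs of a relation\<close>

theorem theorem2:
  fixes scale :: "rat \<Rightarrow> 'v::ab_group_add \<Rightarrow> 'v"
    and n :: nat
    and D :: "('v \<Rightarrow> rat) list \<Rightarrow> rat"
    and a :: "nat \<Rightarrow> 'v \<Rightarrow> rat"
  assumes "vector_space scale"
    and "vector_space.dim scale (UNIV :: 'v set) = n"
    and "n \<ge> 1"
    and "alternating_form scale n D"
    and "nonzero_form scale n D"
    and "\<forall>j\<le>n. a j \<in> dual_space scale \<and> a j \<noteq> 0"
    and "module.span fun_scale (a ` {..n}) = dual_space scale"
  shows "((\<exists>l :: nat \<Rightarrow> rat. (\<forall>j\<le>n. l j > 0) \<and> (\<Sum>j\<le>n. fun_scale (l j) (a j)) = 0) \<longrightarrow>
            (\<exists>e\<in>{-1, 1}. (\<forall>j\<le>n. omit_sign D n a j = e) \<and>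
               cong_mod_lines scale
                 (\<Sum>j\<le>n. fun_scale (omit_sign D n a j) (dual_cone_indicator (omit n a j)))
                 (fun_scale e (indicator {0}))))
       \<and> ((\<exists>l :: nat \<Rightarrow> rat. (\<Sum>j\<le>n. fun_scale (l j) (a j)) = 0 \<and>
              (\<exists>j\<le>n. l j > 0) \<and> (\<exists>j\<le>n. l j < 0)) \<longrightarrow>
            cong_mod_lines scale
              (\<Sum>j\<le>n. fun_scale (omit_sign D n a j) (dual_cone_indicator (omit n a j)))
              0)"
proof -
  note vs = assms(1) and dim = assms(2) and alt = assms(4) and nz = assms(5) and span = assms(7)
  note subspace_lines = line_subspace_subspace[of scale]
  let ?S = "\<Sum>j\<le>n. fun_scale (omit_sign D n a j) (dual_cone_indicator (omit n a j))"
  let ?c = "\<lambda>j. indicator (dual_cone a ({..n} - {j})) :: 'v \<Rightarrow> rat"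
  have S_eq: "?S = fun_scale e (\<Sum>j\<le>n. fun_scale (sgn (l j)) (?c j))"
    if "\<And>j. j \<le> n \<Longrightarrow> omit_sign D n a j = e * sgn (l j)" for e l
    unfolding fun_space.scale_sum_right using that
    by (intro sum.cong) (auto simp: dual_cone_indicator_omit fun_space.scale_scale)
  \<comment> \<open>If \<open>l j\<close> is zero, the sign removes the term. Otherwise the forms
    without \<open>a j\<close> are a basis of the dual space and define a closed polyhedral
    cone.\<close>
  have S_in: "?S \<in> cone_algebra scale"
    if rel: "(\<Sum>j\<le>n. fun_scale (l j) (a j)) = 0"
      and e: "\<And>j. j \<le> n \<Longrightarrow> omit_sign D n a j = e * sgn (l j)" for l e
  proof (intro sum_in_cone_algebra)
    fix j assume "j \<in> {..n}"
    then have j: "j \<le> n" by simp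
    show "fun_scale (omit_sign D n a j) (dual_cone_indicator (omit n a j)) \<in> cone_algebra scale"
    proof (cases "l j = 0")
      case True
      then show ?thesis
        using e[OF j] by (simp add: fun_space.scale_zero_left zero_in_cone_algebra)
    next
      case False
      have "closed_polyhedral_cone scale (dual_cone a ({..n} - {j}))"
        by (rule dual_cone_subset_omit(1)[OF vs dim span rel j False]) simp
      then show ?thesis
        using j by (simp add: dual_cone_indicator_omit cone_algebra.scale
            indicator_closed_cone_in_cone_algebra)
    qed
  qed
  show ?thesis
  proof (intro conjI impI)
    assume "\<exists>l. (\<forall>j\<le>n. l j > 0) \<and> (\<Sum>j\<le>n. fun_scale (l j) (a j)) = 0"
    then obtain l where pos: "\<forall>j\<le>n. l j > 0" and rel: "(\<Sum>j\<le>n. fun_scale (l j) (a j)) = 0"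
      by blast
    have "\<exists>k\<le>n. l k \<noteq> 0"
      using pos by force
    from omit_sign_eq_sgn[OF vs alt nz span rel this]
    obtain e where e: "e \<in> {-1, 1}" "\<And>j. j \<le> n \<Longrightarrow> omit_sign D n a j = e * sgn (l j)"
      by blast
    \<comment> \<open>On this cone the relation with positive coefficients is a vanishing sum of
      nonnegative terms, so all forms vanish, and they separate vectors.\<close>
    have "dual_cone a {..n} = {0}"
    proof -
      have "v = 0" if "v \<in> dual_cone a {..n}" for v
      proof (rule spanning_forms_separate[OF vs span])
        have nn: "\<forall>i\<in>{..n}. 0 \<le> l i * a i v"
          using that pos by (auto simp: dual_cone_def less_imp_le)
        then have "\<forall>i\<in>{..n}. l i * a i v = 0"
          using relation_apply[OF rel, of v] sum_nonneg_eq_0_iff[of "{..n}" "\<lambda>i. l i * a i v"] by blast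
        moreover have "l i \<noteq> 0" if "i \<in> {..n}" for i
          using that pos by force
        ultimately show "a i v = 0" if "i \<in> {..n}" for i
          using that by (metis mult_eq_0_iff)
      qed
      moreover have "a i 0 = 0" if "i \<le> n" for i
        using dual_zero[OF vs, of "a i"] assms(6) that by blast
      then have "0 \<in> dual_cone a {..n}"
        by (simp add: dual_cone_def)
      ultimately show ?thesis by blast
    qed
    moreover have "(\<Sum>j\<le>n. ?c j) - indicator (dual_cone a {..n}) \<in> line_subspace scale"
      by (rule sum_omit_cones_mod_lines[OF vs dim span rel]) (use pos in auto)
    ultimately have "fun_scale e ((\<Sum>j\<le>n. ?c j) - indicator {0}) \<in> line_subspace scale"
      by (auto intro: fun_space.subspace_scale[OF subspace_lines])
    moreover have "?S = fun_scale e (\<Sum>j\<le>n. ?c j)"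
    proof -
      have "?S = fun_scale e (\<Sum>j\<le>n. fun_scale (sgn (l j)) (?c j))"
        by (rule S_eq[OF e(2)])
      also have "(\<Sum>j\<le>n. fun_scale (sgn (l j)) (?c j)) = (\<Sum>j\<le>n. ?c j)"
        using pos by (intro sum.cong) simp_all
      finally show ?thesis .
    qed
    ultimately have "cong_mod_lines scale ?S (fun_scale e (indicator {0}))"
      unfolding cong_mod_lines_def using S_in[OF rel e(2)]
      by (auto simp: fun_space.scale_right_diff_distrib intro: cone_algebra.scale delta_in_cone_algebra)
    then show "\<exists>e\<in>{-1, 1}. (\<forall>j\<le>n. omit_sign D n a j = e) \<and>
        cong_mod_lines scale ?S (fun_scale e (indicator {0}))"
      using e pos by (intro bexI[of _ e]) auto
  next
    assume "\<exists>l. (\<Sum>j\<le>n. fun_scale (l j) (a j)) = 0 \<and> (\<exists>j\<le>n. l j > 0) \<and> (\<exists>j\<le>n. l j < 0)"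
    then obtain l where rel: "(\<Sum>j\<le>n. fun_scale (l j) (a j)) = 0"
      and ex: "\<exists>j\<le>n. l j > 0" "\<exists>j\<le>n. l j < 0"
      by blast
    have "\<exists>k\<le>n. l k \<noteq> 0"
      using ex by force
    from omit_sign_eq_sgn[OF vs alt nz span rel this]
    obtain e where e: "\<And>j. j \<le> n \<Longrightarrow> omit_sign D n a j = e * sgn (l j)"
      by blast
    define P where "P = {j. j \<le> n \<and> 0 < l j}"
    define N where "N = {j. j \<le> n \<and> l j < 0}"
    \<comment> \<open>\<open>N\<close> is the set of positive coefficients of the negated relation.
      Both congruences have the same right-hand side, the cone of all forms, which cancels in their
      difference.\<close>
    have rel': "(\<Sum>j\<le>n. fun_scale (- l j) (a j)) = 0"
      using rel by (simp add: sum_negf fun_space.scale_minus_left)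
    have "(\<Sum>j\<in>P. ?c j) - indicator (dual_cone a {..n}) \<in> line_subspace scale"
      by (rule sum_omit_cones_mod_lines[OF vs dim span rel]) (use ex in \<open>auto simp: P_def\<close>)
    moreover have "(\<Sum>j\<in>N. ?c j) - indicator (dual_cone a {..n}) \<in> line_subspace scale"
      by (rule sum_omit_cones_mod_lines[OF vs dim span rel']) (use ex in \<open>auto simp: N_def\<close>)
    ultimately have "(\<Sum>j\<in>P. ?c j) - (\<Sum>j\<in>N. ?c j) \<in> line_subspace scale"
      using fun_space.subspace_diff[OF subspace_lines] by fastforce
    also have "(\<Sum>j\<in>P. ?c j) - (\<Sum>j\<in>N. ?c j) = (\<Sum>j\<le>n. fun_scale (sgn (l j)) (?c j))"
    proof -
      have "(\<Sum>j\<le>n. fun_scale (sgn (l j)) (?c j)) = (\<Sum>j\<in>P \<union> N. fun_scale (sgn (l j)) (?c j))"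
        by (intro sum.mono_neutral_right) (auto simp: P_def N_def fun_space.scale_zero_left sgn_if)
      also have "\<dots> = (\<Sum>j\<in>P. fun_scale (sgn (l j)) (?c j)) + (\<Sum>j\<in>N. fun_scale (sgn (l j)) (?c j))"
        by (intro sum.union_disjoint) (auto simp: P_def N_def)
      also have "(\<Sum>j\<in>P. fun_scale (sgn (l j)) (?c j)) = (\<Sum>j\<in>P. ?c j)"
        by (intro sum.cong) (auto simp: P_def)
      also have "(\<Sum>j\<in>N. fun_scale (sgn (l j)) (?c j)) = - (\<Sum>j\<in>N. ?c j)"
        unfolding sum_negf[symmetric] by (intro sum.cong) (auto simp: N_def fun_space.scale_minus_left)
      finally show ?thesis
        unfolding diff_conv_add_uminus by (rule sym)
    qed
    finally have "fun_scale e (\<Sum>j\<le>n. fun_scale (sgn (l j)) (?c j)) \<in> line_subspace scale"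
      by (rule fun_space.subspace_scale[OF subspace_lines])
    then have "?S \<in> line_subspace scale"
      by (subst S_eq[OF e])
    then show "cong_mod_lines scale ?S 0"
      unfolding cong_mod_lines_def using S_in[OF rel e] zero_in_cone_algebra by simp
  qed
qed

end
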